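(* Let $T\in \mathcal{B}_A(\mathcal{H})$. Then $$d\omega_A(T) \leq \sqrt{\frac{1}{2}\Big[\omega_A\Big((T^\sharp T)^2 + T^\sharp T\Big)+ \omega_A\Big((T^\sharp T)^2 - T^\sharp T\Big)\Big] + \omega_A(T^\sharp T^2)}.$$
   Context: $\mathcal{H}$ is a complex Hilbert space with inner product $\langle\cdot\mid\cdot\rangle$, $\mathcal{B}(\mathcal{H})$ is the algebra of bounded linear operators on $\mathcal{H}$, and $A\in\mathcal{B}(\mathcal{H})$ is a fixed nonzero positive (semidefinite) operator. Put $\langle x\mid y\rangle_A=\langle Ax\mid y\rangle$ and $\|x\|_A=\langle x\mid x\rangle_A^{1/2}$. $\mathcal{B}_A(\mathcal{H})=\{T\in\mathcal{B}(\mathcal{H}) : \mathcal{R}(T^*A)\subseteq\mathcal{R}(A)\}$, where $\mathcal{R}$ denotes range; for $T\in\mathcal{B}_A(\mathcal{H})$, $T^\sharp$ denotes the unique $X\in\mathcal{B}(\mathcal{H})$ with $AX=T^*A$ and $\mathcal{R}(X)\subseteq\overline{\mathcal{R}(A)}$ (so $\langle Tx\mid y\rangle_A=\langle x\mid T^\sharp y\rangle_A$); $T^\sharp T^2$ means the product $T^\sharp\cdot T\cdot T$. For $T\in\mathcal{B}_A(\mathcal{H})$: $\omega_A(T)=\sup\{|\langle Tx\mid x\rangle_A| : \|x\|_A=1\}$, and the $A$-Davis-Wielandt radius is $d\omega_A(T)=\sup\{\sqrt{|\langle Tx\mid x\rangle_A|^2+\|Tx\|_A^4} : \|x\|_A=1\}$;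 both are finite. *)

theory Defs
  imports "HOL-Analysis.Analysis" "HOL-Library.Nonpos_Ints"
begin

text \<open>
  Complex inner product spaces, as a type class over the library's real normed spaces. The inner
  product is linear in its first argument; the real scalar multiplication and the norm (hence the
  topology) are the ones induced by the complex structure.
\<close>

class complex_inner_space = real_normed_vector +
  fixes scaleC :: "complex \<Rightarrow> 'a \<Rightarrow> 'a"
    and cinner :: "'a \<Rightarrow> 'a \<Rightarrow> complex"
  assumes scaleC_add_right: "scaleC c (x + y) = scaleC c x + scaleC c y"
    and scaleC_add_left: "scaleC (c + d) x = scaleC c x + scaleC d x"
    and scaleC_scaleC: "scaleC c (scaleC d x) = scaleC (c * d) x"
    and scaleC_one: "scaleC 1 x = x"
    and scaleR_scaleC: "scaleR r x = scaleC (complex_of_real r) x"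
    and cinner_commute: "cinner x y = cnj (cinner y x)"
    and cinner_add_left: "cinner (x + y) z = cinner x z + cinner y z"
    and cinner_scaleC_left: "cinner (scaleC c x) y = c * cinner x y"
    and cinner_self_nonneg: "cinner x x \<in> \<real>\<^sub>\<ge>\<^sub>0"
    and cinner_self_eq_zero_iff: "cinner x x = 0 \<longleftrightarrow> x = 0"
    and norm_eq_sqrt_cinner: "norm x = sqrt (Re (cinner x x))"

class complex_hilbert_space = complex_inner_space + complete_space

instantiation complex :: complex_hilbert_space
begin

definition scaleC_complex :: "complex \<Rightarrow> complex \<Rightarrow> complex"
  where "scaleC_complex c x = c * x"

definition cinner_complex :: "complex \<Rightarrow> complex \<Rightarrow> complex"
  where "cinner_complex x y = x * cnj y"

instance
proof
  fix x :: complex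
  have *: "cinner x x = complex_of_real ((norm x)\<^sup>2)"
    by (simp only: cinner_complex_def complex_norm_square)
  show "cinner x x \<in> \<real>\<^sub>\<ge>\<^sub>0"
    unfolding * by (simp del: of_real_power)
  show "norm x = sqrt (Re (cinner x x))"
    unfolding * by (simp del: of_real_power)
qed (auto simp: scaleC_complex_def cinner_complex_def algebra_simps scaleR_conv_of_real)

end

definition bounded_clinear :: "('a::complex_inner_space \<Rightarrow> 'b::complex_inner_space) \<Rightarrow> bool"
  where "bounded_clinear T \<longleftrightarrow> bounded_linear T \<and> (\<forall>c x. T (scaleC c x) = scaleC c (T x))"

definition adjoint_op :: "('a::complex_hilbert_space \<Rightarrow> 'a) \<Rightarrow> 'a \<Rightarrow> 'a"
  where "adjoint_op T =
    (THE S. bounded_clinear S \<and> (\<forall>x y. cinner (T x) y = cinner x (S y)))"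

definition positive_op :: "('a::complex_hilbert_space \<Rightarrow> 'a) \<Rightarrow> bool"
  where "positive_op A \<longleftrightarrow> bounded_clinear A \<and> (\<forall>x. cinner (A x) x \<in> \<real>\<^sub>\<ge>\<^sub>0)"

definition A_inner :: "('a::complex_hilbert_space \<Rightarrow> 'a) \<Rightarrow> 'a \<Rightarrow> 'a \<Rightarrow> complex"
  where "A_inner A x y = cinner (A x) y"

definition A_norm :: "('a::complex_hilbert_space \<Rightarrow> 'a) \<Rightarrow> 'a \<Rightarrow> real"
  where "A_norm A x = sqrt (Re (A_inner A x x))"

definition A_adjointable :: "('a::complex_hilbert_space \<Rightarrow> 'a) \<Rightarrow> ('a \<Rightarrow> 'a) set"
  where "A_adjointable A = {T. bounded_clinear T \<and> range (adjoint_op T \<circ> A) \<subseteq> range A}"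

text \<open>The distinguished \<open>A\<close>-adjoint; the description is meaningful for positive \<open>A\<close> and
  \<open>T \<in> A_adjointable A\<close>.\<close>

definition A_sharp :: "('a::complex_hilbert_space \<Rightarrow> 'a) \<Rightarrow> ('a \<Rightarrow> 'a) \<Rightarrow> 'a \<Rightarrow> 'a"
  where "A_sharp A T =
    (THE X. bounded_clinear X \<and> A \<circ> X = adjoint_op T \<circ> A \<and> range X \<subseteq> closure (range A))"

text \<open>Both suprema are taken in \<open>real\<close>; for positive \<open>A \<noteq> 0\<close> and \<open>T \<in> A_adjointable A\<close> the
  sets involved are nonempty and bounded above.\<close>

definition A_numerical_radius :: "('a::complex_hilbert_space \<Rightarrow> 'a) \<Rightarrow> ('a \<Rightarrow> 'a) \<Rightarrow> real"
  where "A_numerical_radius A T = (SUP x\<in>{x. A_norm A x = 1}. cmod (A_inner A (T x) x))"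

definition A_Davis_Wielandt_radius :: "('a::complex_hilbert_space \<Rightarrow> 'a) \<Rightarrow> ('a \<Rightarrow> 'a) \<Rightarrow> real"
  where "A_Davis_Wielandt_radius A T =
    (SUP x\<in>{x. A_norm A x = 1}. sqrt ((cmod (A_inner A (T x) x))\<^sup>2 + A_norm A (T x) ^ 4))"

end

theory Submission imports Defs begin

text \<open>
  For a semi-inner product, Cauchy-Schwarz applied to \<open>x\<close> and \<open>\<langle>x, a\<rangle> a + \<langle>x, b\<rangle> b\<close> gives
  \<open>\<bar>\<langle>x, a\<rangle>\<bar>\<^sup>2 + \<bar>\<langle>x, b\<rangle>\<bar>\<^sup>2 \<le> \<parallel>x\<parallel>\<^sup>2 (max \<parallel>a\<parallel>\<^sup>2 \<parallel>b\<parallel>\<^sup>2 + \<bar>\<langle>a, b\<rangle>\<bar>)\<close>. Take \<open>a = T x\<close> and \<open>b = S x\<close>, where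
  \<open>S = T\<^sup>\<sharp> T\<close>, in the \<open>A\<close>-semi-inner product: then \<open>\<langle>x, b\<rangle> = \<parallel>T x\<parallel>\<^sup>2\<close>, \<open>\<langle>a, b\<rangle>\<close> equals
  \<open>\<langle>T\<^sup>\<sharp> T\<^sup>2 x, x\<rangle>\<close>, and the maximum of \<open>\<parallel>a\<parallel>\<^sup>2 = \<langle>S x, x\<rangle>\<close> and \<open>\<parallel>b\<parallel>\<^sup>2 = \<langle>S\<^sup>2 x, x\<rangle>\<close> is half the
  sum of \<open>\<langle>(S\<^sup>2 + S) x, x\<rangle>\<close> and \<open>\<bar>\<langle>(S\<^sup>2 - S) x, x\<rangle>\<bar>\<close>. The suprema involved are finite because \<open>S\<close>,
  being bounded and \<open>A\<close>-symmetric, is bounded in the \<open>A\<close>-seminorm.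
\<close>

section \<open>Semi-inner products: Cauchy-Schwarz and its consequences\<close>

lemma scaleC_zero_left [simp]: "scaleC 0 (x::'a::complex_inner_space) = 0"
  using scaleR_scaleC[of 0 x] by simp

lemma scaleC_minus_one [simp]: "scaleC (-1) (x::'a::complex_inner_space) = - x"
  using scaleR_scaleC[of "-1" x] by simp

locale semi_inner =
  fixes g :: "'a::complex_inner_space \<Rightarrow> 'a \<Rightarrow> complex"
  assumes add_left: "g (x + y) z = g x z + g y z"
    and scaleC_left: "g (scaleC c x) y = c * g x y"
    and hermitian: "g x y = cnj (g y x)"
    and nonneg: "0 \<le> Re (g x x)"
begin

definition seminorm :: "'a \<Rightarrow> real"
  where "seminorm x = sqrt (Re (g x x))"

lemma add_right: "g z (x + y) = g z x + g z y"
  by (metis add_left complex_cnj_add hermitian)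

lemma scaleC_right: "g y (scaleC c x) = cnj c * g y x"
  by (metis complex_cnj_mult hermitian scaleC_left)

lemma zero_left [simp]: "g 0 y = 0"
  using scaleC_left[of 0 0 y] by simp

lemma zero_right [simp]: "g y 0 = 0"
  using hermitian[of y 0] by simp

lemma minus_left: "g (- x) y = - g x y"
  using scaleC_left[of "-1" x y] by simp

lemma minus_right: "g y (- x) = - g y x"
  using scaleC_right[of y "-1" x] by simp

lemma diff_left: "g (x - y) z = g x z - g y z"
  using add_left[of x "- y" z] by (simp add: minus_left)

lemma diff_right: "g z (x - y) = g z x - g z y"
  using add_right[of z x "- y"] by (simp add: minus_right)

lemma self_complex: "g x x = complex_of_real (Re (g x x))"
  using hermitian[of x x] by (simp add: complex_eq_iff)

lemma seminorm_nonneg [simp]: "0 \<le> seminorm x"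
  by (simp add: seminorm_def nonneg)

lemma seminorm_power2: "(seminorm x)\<^sup>2 = Re (g x x)"
  by (simp add: seminorm_def nonneg)

lemma cmod_commute: "cmod (g x y) = cmod (g y x)"
  by (metis complex_mod_cnj hermitian)

lemma Re_add_self: "Re (g (x + y) (x + y)) = Re (g x x) + 2 * Re (g x y) + Re (g y y)"
proof -
  have "Re (g y x) = Re (g x y)"
    by (metis hermitian cnj.simps(1))
  then show ?thesis
    by (simp add: add_left add_right)
qed

text \<open>The form is nonnegative at \<open>x - t w y\<close> for every real \<open>t\<close>,
  where \<open>w = g x y\<close>. Since \<open>g\<close> may be degenerate, \<open>b = 0\<close>
  does not force \<open>w = 0\<close> outright and needs its own case.\<close>

lemma Cauchy_Schwarz: "cmod (g x y) \<le> seminorm x * seminorm y"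
proof -
  define w where "w = g x y"
  define a where "a = Re (g x x)"
  define b where "b = Re (g y y)"
  have ab: "0 \<le> a" "0 \<le> b"
    by (simp_all add: a_def b_def nonneg)
  have key: "0 \<le> a - 2 * t * (cmod w)\<^sup>2 + t\<^sup>2 * (cmod w)\<^sup>2 * b" for t :: real
  proof -
    \<comment> \<open>The factor \<open>w\<close> aligns the phase of \<open>y\<close> with that of
      \<open>x\<close>, so the cross term is real and the expansion is a real quadratic in
      \<open>t\<close>.\<close>
    define c where "c = - complex_of_real t * w"
    have "0 \<le> Re (g (x + scaleC c y) (x + scaleC c y))"
      by (rule nonneg)
    also have "\<dots> = a + 2 * Re (cnj c * w) + Re (c * cnj c * g y y)"
      unfolding Re_add_self a_def w_def by (simp only: scaleC_left scaleC_right mult.assoc mult.left_commute[of c])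
    also have "c * cnj c * g y y = complex_of_real ((cmod c)\<^sup>2 * b)"
      using self_complex[of y] by (metis b_def complex_norm_square of_real_mult)
    also have "(cmod c)\<^sup>2 = t\<^sup>2 * (cmod w)\<^sup>2"
      by (simp add: c_def norm_mult power_mult_distrib)
    also have "cnj c * w = complex_of_real (- t * (cmod w)\<^sup>2)"
      unfolding c_def by (simp only: of_real_mult complex_norm_square) simp
    finally show ?thesis
      by simp
  qed
  have "(cmod w)\<^sup>2 \<le> a * b"
  proof (cases "b = 0")
    case True
    have "(cmod w)\<^sup>2 = 0"
    proof (rule ccontr)
      assume "(cmod w)\<^sup>2 \<noteq> 0"
      then show False
        \<comment> \<open>With \<open>b = 0\<close> the quadratic is affine in \<open>t\<close>;
          this \<open>t\<close> gives it the value \<open>-1\<close>.\<close>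
        using key[of "(a + 1) / (2 * (cmod w)\<^sup>2)"] True by (simp add: field_simps)
    qed
    then show ?thesis
      using True by simp
  next
    case False
    then show ?thesis
      \<comment> \<open>\<open>1 / b\<close> is the minimiser of the quadratic.\<close>
      using key[of "1 / b"] ab by (simp add: field_simps power2_eq_square)
  qed
  then show ?thesis
    unfolding w_def a_def b_def seminorm_def real_sqrt_mult[symmetric]
    by (rule real_le_rsqrt)
qed

lemma sum_square_inner_le:
  "(cmod (g x a))\<^sup>2 + (cmod (g x b))\<^sup>2
    \<le> (seminorm x)\<^sup>2 * (max ((seminorm a)\<^sup>2) ((seminorm b)\<^sup>2) + cmod (g a b))"
proof -
  define p where "p = g x a"
  define q where "q = g x b"
  define s where "s = (cmod p)\<^sup>2 + (cmod q)\<^sup>2"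
  define m where "m = max ((seminorm a)\<^sup>2) ((seminorm b)\<^sup>2)"
  \<comment> \<open>\<open>g\<close> is conjugate-linear in its second argument, so these
    coefficients turn \<open>g x y\<close> into the sum of squares \<open>s\<close>.\<close>
  define y where "y = scaleC p a + scaleC q b"
  have s0: "0 \<le> s"
    by (simp add: s_def)
  have "g x y = complex_of_real s"
    unfolding y_def s_def of_real_add complex_norm_square
    by (simp add: add_right scaleC_right p_def q_def mult.commute)
  then have "s \<le> seminorm x * seminorm y"
    using Cauchy_Schwarz[of x y] s0 by simp
  then have 1: "s\<^sup>2 \<le> (seminorm x)\<^sup>2 * (seminorm y)\<^sup>2"
    using s0 by (simp add: power_mono flip: power_mult_distrib)
  have sq: "Re (g (scaleC c z) (scaleC c z)) = (cmod c)\<^sup>2 * (seminorm z)\<^sup>2" for c z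
  proof -
    have "g (scaleC c z) (scaleC c z) = complex_of_real ((cmod c)\<^sup>2) * g z z"
      unfolding complex_norm_square by (simp add: scaleC_left scaleC_right mult.assoc)
    then show ?thesis
      by (simp add: seminorm_power2)
  qed
  have cross: "g (scaleC p a) (scaleC q b) = p * cnj q * g a b"
    by (simp add: scaleC_left scaleC_right)
  have "(seminorm y)\<^sup>2 = Re (g y y)"
    by (rule seminorm_power2)
  also have "\<dots> = (cmod p)\<^sup>2 * (seminorm a)\<^sup>2 + 2 * Re (p * cnj q * g a b)
      + (cmod q)\<^sup>2 * (seminorm b)\<^sup>2"
    unfolding y_def Re_add_self sq cross ..
  also have "\<dots> \<le> (cmod p)\<^sup>2 * m + s * cmod (g a b) + (cmod q)\<^sup>2 * m"
  proof (intro add_mono mult_left_mono)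
    have "2 * Re (p * cnj q * g a b) \<le> 2 * cmod p * cmod q * cmod (g a b)"
      using complex_Re_le_cmod[of "p * cnj q * g a b"] by (simp add: norm_mult)
    also have "\<dots> \<le> s * cmod (g a b)"
      unfolding s_def by (intro mult_right_mono sum_squares_bound norm_ge_zero)
    finally show "2 * Re (p * cnj q * g a b) \<le> s * cmod (g a b)" .
  qed (auto simp: m_def)
  also have "\<dots> = s * (m + cmod (g a b))"
    by (simp add: s_def algebra_simps)
  finally have "(seminorm x)\<^sup>2 * (seminorm y)\<^sup>2 \<le> (seminorm x)\<^sup>2 * (s * (m + cmod (g a b)))"
    by (rule mult_left_mono) simp
  with 1 have 2: "s * s \<le> s * ((seminorm x)\<^sup>2 * (m + cmod (g a b)))"
    by (simp add: power2_eq_square mult_ac)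
  have "0 \<le> (seminorm x)\<^sup>2 * (m + cmod (g a b))"
    by (simp add: m_def le_max_iff_disj)
  \<comment> \<open>One factor \<open>s\<close> cancels; if \<open>s = 0\<close>, nonnegativity of
    the right-hand side suffices.\<close>
  with 2 have "s \<le> (seminorm x)\<^sup>2 * (m + cmod (g a b))"
    using s0 by (cases "s = 0") auto
  then show ?thesis
    by (simp add: s_def m_def p_def q_def)
qed

text \<open>M. G. Krein's argument: by Cauchy-Schwarz the seminorms of \<open>S\<^sup>n x\<close> are log-convex in \<open>n\<close>, so
  their first ratio cannot exceed their exponential growth rate.\<close>

lemma symmetric_seminorm_le:
  assumes sym: "\<And>x y. g (S x) y = g x (S y)"
    and c: "0 < c"
    and growth: "\<And>n. seminorm ((S ^^ n) x) \<le> K * c ^ n"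
  shows "seminorm (S x) \<le> c * seminorm x"
proof -
  define f where "f n = seminorm ((S ^^ n) x)" for n
  have f0: "0 \<le> f n" for n
    by (simp add: f_def)
  \<comment> \<open>Symmetry moves one \<open>S\<close> across: \<open>\<langle>S^(n+1) x, S^(n+1)
    x\<rangle> = \<langle>S^n x, S^(n+2) x\<rangle>\<close>.\<close>
  have logconv: "(f (Suc n))\<^sup>2 \<le> f n * f (Suc (Suc n))" for n
  proof -
    have "(f (Suc n))\<^sup>2 = Re (g ((S ^^ n) x) ((S ^^ Suc (Suc n)) x))"
      unfolding f_def seminorm_power2 by (simp add: sym)
    also have "\<dots> \<le> f n * f (Suc (Suc n))"
      unfolding f_def using Cauchy_Schwarz complex_Re_le_cmod order_trans by blast
    finally show ?thesis .
  qed
  \<comment> \<open>Log-convexity makes the ratios \<open>f (Suc n) / f n\<close> nondecreasing. The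
    multiplied-out form also covers vanishing \<open>f n\<close>.\<close>
  have ratio: "f 1 * f n \<le> f (Suc n) * f 0" for n
  proof (induction n)
    case (Suc n)
    show ?case
    proof (cases "f n = 0")
      case True
      then have "f (Suc n) = 0"
        using logconv[of n] by simp
      then show ?thesis
        using f0 by simp
    next
      case False
      then have pos: "0 < f n"
        using f0[of n] by simp
      have "f n * (f 1 * f (Suc n)) \<le> f (Suc n) * (f (Suc n) * f 0)"
        using mult_left_mono[OF Suc f0[of "Suc n"]] by (simp add: mult_ac)
      also have "\<dots> \<le> f n * (f (Suc (Suc n)) * f 0)"
        using mult_right_mono[OF logconv[of n] f0[of 0]] by (simp add: power2_eq_square mult_ac)
      finally show ?thesis
        using pos by simp
    qed
  qed simp
  \<comment> \<open>The ratios telescope to \<open>f n \<ge> f 0 * (f 1 / f 0) ^ n\<close>, again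
    cleared of denominators.\<close>
  have pow: "f 0 * f 1 ^ n \<le> f n * f 0 ^ n" for n
  proof (induction n)
    case (Suc n)
    have "f 0 * f 1 ^ Suc n \<le> f 1 * f n * f 0 ^ n"
      using mult_left_mono[OF Suc f0[of 1]] by (simp add: mult_ac)
    also have "\<dots> \<le> f (Suc n) * f 0 * f 0 ^ n"
      by (rule mult_right_mono[OF ratio]) (simp add: f0)
    finally show ?case
      by (simp add: mult_ac)
  qed simp
  have "f 1 \<le> c * f 0"
  proof (cases "f 0 = 0")
    case True
    then show ?thesis
      using logconv[of 0] by simp
  next
    case False
    then have pos: "0 < f 0"
      using f0[of 0] by simp
    show ?thesis
    proof (rule ccontr)
      assume "\<not> ?thesis"
      \<comment> \<open>A first ratio above \<open>c\<close> has powers, relative to those of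
        \<open>c\<close>, that are unbounded, while \<open>pow\<close> and \<open>growth\<close> cap
        them at \<open>K / f 0\<close>.\<close>
      then have "1 < f 1 / (c * f 0)"
        using pos c by (simp add: field_simps)
      then obtain n where n: "K / f 0 < (f 1 / (c * f 0)) ^ n"
        using real_arch_pow by blast
      have "f 0 * f 1 ^ n \<le> K * c ^ n * f 0 ^ n"
        using pow[of n] mult_right_mono[OF growth[of n], of "f 0 ^ n"] f0[of 0]
        by (simp add: f_def)
      then have "(f 1 / (c * f 0)) ^ n \<le> K / f 0"
        using pos c by (simp add: field_simps power_mult_distrib power_divide)
      with n show False
        by simp
    qed
  qed
  then show ?thesis
    by (simp add: f_def)
qed

end

section \<open>The inner product of the space as a semi-inner product\<close>

interpretation cinner: semi_inner "cinner :: 'a::complex_inner_space \<Rightarrow> 'a \<Rightarrow> complex"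
  rewrites "semi_inner.seminorm (cinner :: 'a \<Rightarrow> 'a \<Rightarrow> complex) = norm"
proof -
  show *: "semi_inner (cinner :: 'a \<Rightarrow> 'a \<Rightarrow> complex)"
    by (intro semi_inner.intro cinner_add_left cinner_scaleC_left cinner_commute)
      (metis cinner_self_nonneg complex_nonneg_Reals_iff)
  show "semi_inner.seminorm (cinner :: 'a \<Rightarrow> 'a \<Rightarrow> complex) = norm"
    by (rule ext) (simp add: semi_inner.seminorm_def[OF *] norm_eq_sqrt_cinner)
qed

lemma norm_scaleC: "norm (scaleC c (x::'a::complex_inner_space)) = cmod c * norm x"
proof -
  have "cinner (scaleC c x) (scaleC c x) = complex_of_real ((cmod c)\<^sup>2) * cinner x x"
    unfolding complex_norm_square by (simp add: cinner.scaleC_left cinner.scaleC_right mult.assoc)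
  then show ?thesis
    by (simp add: norm_eq_sqrt_cinner[of x] norm_eq_sqrt_cinner[of "scaleC c x"] real_sqrt_mult)
qed

lemma cinner_eqI: "(\<And>z. cinner z x = cinner z y) \<Longrightarrow> x = (y::'a::complex_inner_space)"
  by (metis cinner.diff_right cinner_self_eq_zero_iff eq_iff_diff_eq_0)

lemma cinner_scaleR_left: "cinner (r *\<^sub>R x) (y::'a::complex_inner_space) = complex_of_real r * cinner x y"
  unfolding scaleR_scaleC by (rule cinner.scaleC_left)

lemma bounded_linear_cinner_left: "bounded_linear (\<lambda>x::'a::complex_inner_space. cinner x y)"
  by (rule bounded_linear_intro[where K = "norm y"])
    (simp_all add: cinner.add_left cinner_scaleR_left cinner.Cauchy_Schwarz scaleR_conv_of_real)

section \<open>Riesz representation on closed subspaces\<close>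

lemma power2_norm_add:
  "(norm (x + y :: 'a::complex_inner_space))\<^sup>2 = (norm x)\<^sup>2 + 2 * Re (cinner x y) + (norm y)\<^sup>2"
  using cinner.Re_add_self[of x y] by (simp add: cinner.seminorm_power2)

text \<open>The representing vector minimises \<open>J v = \<parallel>v\<parallel>\<^sup>2 - 2 f v\<close> over \<open>L\<close>.\<close>

lemma Riesz_on_subspace:
  fixes f :: "'a::complex_hilbert_space \<Rightarrow> real"
  assumes f: "bounded_linear f" and L: "subspace L" "closed L"
  shows "\<exists>v\<in>L. \<forall>x\<in>L. f x = Re (cinner x v)"
proof -
  interpret f: bounded_linear f by fact
  define J where "J v = (norm v)\<^sup>2 - 2 * f v" for v
  define m where "m = (INF v\<in>L. J v)"
  obtain K where K: "\<bar>f v\<bar> \<le> norm v * K" for v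
    using f.bounded by (auto simp: real_norm_def)
  \<comment> \<open>Completing the square in \<open>norm v\<close> bounds \<open>J\<close> below, so
    its infimum is meaningful.\<close>
  have "- (K\<^sup>2) \<le> J v" for v
  proof -
    have "0 \<le> (norm v - K)\<^sup>2"
      by simp
    then show ?thesis
      using K[of v] by (simp add: J_def power2_diff)
  qed
  then have bdd: "bdd_below (J ` L)"
    by (meson bdd_belowI2)
  have ne: "L \<noteq> {}"
    using L(1) subspace_0 by blast
  have m_le: "m \<le> J v" if "v \<in> L" for v
    unfolding m_def by (rule cINF_lower[OF bdd that])
  have "\<exists>v\<in>L. J v < m + 1 / real (Suc n)" for n
    using cINF_less_iff[OF ne bdd, of "m + 1 / real (Suc n)"] by (simp add: m_def)
  then obtain u where uL: "\<And>n. u n \<in> L" and u: "\<And>n. J (u n) < m + 1 / real (Suc n)"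
    by metis
  define mid where "mid x y = (1/2) *\<^sub>R (x + y)" for x y :: 'a
  \<comment> \<open>Parallelogram law: the linear terms of \<open>J\<close> cancel. As
    \<open>J\<close> is at least \<open>m\<close> at midpoints, near-minimisers must be close to
    each other, so a minimising sequence is Cauchy.\<close>
  have par: "(norm (x - y))\<^sup>2 = 2 * J x + 2 * J y - 4 * J (mid x y)" for x y
  proof -
    have "(norm (x - y))\<^sup>2 = (norm x)\<^sup>2 - 2 * Re (cinner x y) + (norm y)\<^sup>2"
      using power2_norm_add[of x "- y"] by (simp add: cinner.minus_right)
    moreover have "J (mid x y) = (norm (x + y))\<^sup>2 / 4 - (f x + f y)"
      unfolding mid_def J_def f.scaleR f.add norm_scaleR real_scaleR_def
      by (simp add: power_divide field_simps)
    ultimately show ?thesis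
      unfolding J_def[of x] J_def[of y] using power2_norm_add[of x y] by (simp add: algebra_simps)
  qed
  have close: "(norm (u i - u j))\<^sup>2 < 2 * (1 / real (Suc i)) + 2 * (1 / real (Suc j))" for i j
  proof -
    have "mid (u i) (u j) \<in> L"
      using L(1) uL by (simp add: mid_def subspace_add subspace_scale)
    from m_le[OF this] show ?thesis
      unfolding par using u[of i] u[of j] by linarith
  qed
  have "Cauchy u"
  proof (rule metric_CauchyI)
    fix e :: real
    assume e: "0 < e"
    then obtain N where N: "4 / e\<^sup>2 < real (Suc N)"
      by (meson reals_Archimedean2 less_trans lessI of_nat_less_iff)
    show "\<exists>M. \<forall>i\<ge>M. \<forall>j\<ge>M. dist (u i) (u j) < e"
    proof (intro exI allI impI)
      fix i j
      assume ij: "N \<le> i" "N \<le> j"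
      have "1 / real (Suc i) \<le> 1 / real (Suc N)" "1 / real (Suc j) \<le> 1 / real (Suc N)"
        using ij by (simp_all add: frac_le)
      then have "(norm (u i - u j))\<^sup>2 < 4 / real (Suc N)"
        using close[of i j] by linarith
      also have "\<dots> < e\<^sup>2"
        using N e by (simp add: field_simps)
      finally show "dist (u i) (u j) < e"
        using e by (simp add: dist_norm power2_less_imp_less)
    qed
  qed
  then obtain v where v: "u \<longlonglongrightarrow> v"
    using Cauchy_convergent convergent_def by blast
  have vL: "v \<in> L"
    using closed_sequentially[OF L(2)] uL v by blast
  have "(\<lambda>n. J (u n)) \<longlonglongrightarrow> J v"
    unfolding J_def by (intro tendsto_intros v f.tendsto)
  moreover have "(\<lambda>n. m + 1 / real (Suc n)) \<longlonglongrightarrow> m + 0"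
    by (intro tendsto_intros LIMSEQ_Suc[OF lim_1_over_n])
  ultimately have "J v \<le> m + 0"
    by (rule LIMSEQ_le) (use u less_imp_le in blast)
  then have min: "J v \<le> J w" if "w \<in> L" for w
    using m_le[OF that] by simp
  have "f x = Re (cinner x v)" if x: "x \<in> L" for x
  proof -
    define d where "d = Re (cinner x v) - f x"
    \<comment> \<open>Variation of the minimiser in the direction \<open>x\<close>; the linear
      coefficient \<open>d\<close> must vanish.\<close>
    have quad: "0 \<le> t\<^sup>2 * (norm x)\<^sup>2 + 2 * t * d" for t
    proof -
      have "J v \<le> J (t *\<^sub>R x + v)"
        using L(1) x vL by (intro min subspace_add subspace_scale)
      also have "\<dots> = t\<^sup>2 * (norm x)\<^sup>2 + 2 * t * d + J v"
        unfolding J_def power2_norm_add f.add f.scaleR cinner_scaleR_left d_def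
        by (simp add: power_mult_distrib algebra_simps)
      finally show ?thesis
        by simp
    qed
    have "d = 0"
    proof (rule ccontr)
      assume d: "d \<noteq> 0"
      show False
      proof (cases "norm x = 0")
        case True
        then show False
          using d by (simp add: d_def f.zero)
      next
        case False
        \<comment> \<open>The vertex of the quadratic is at \<open>t = - d / (norm x)^2\<close>,
          where its value would be negative.\<close>
        then have "(- d / (norm x)\<^sup>2)\<^sup>2 * (norm x)\<^sup>2 + 2 * (- d / (norm x)\<^sup>2) * d = - (d\<^sup>2 / (norm x)\<^sup>2)"
          by (simp add: field_simps power2_eq_square)
        with quad[of "- d / (norm x)\<^sup>2"] have "d\<^sup>2 / (norm x)\<^sup>2 \<le> 0"
          by simp
        moreover have "0 < d\<^sup>2 / (norm x)\<^sup>2"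
          using d False by simp
        ultimately show False
          by simp
      qed
    qed
    then show ?thesis
      by (simp add: d_def)
  qed
  with vL show ?thesis
    by blast
qed


section \<open>The uniform boundedness principle\<close>

lemma uniform_boundedness:
  fixes F :: "('a::{real_normed_vector,complete_space} \<Rightarrow> 'b::real_normed_vector) set"
  assumes lin: "\<And>f. f \<in> F \<Longrightarrow> bounded_linear f"
    and ptw: "\<And>x. \<exists>M. \<forall>f\<in>F. norm (f x) \<le> M"
  shows "\<exists>C. \<forall>f\<in>F. \<forall>x. norm (f x) \<le> C * norm x"
proof -
  \<comment> \<open>Baire category: these closed sets cover the complete space, so one of them
    contains a ball.\<close>
  define E where "E n = (\<Inter>f\<in>F. {x. norm (f x) \<le> real n})" for n :: nat
  have "closed {x. norm (f x) \<le> real n}" if "f \<in> F" for f n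
    using lin[OF that] by (intro closed_Collect_le continuous_on_norm continuous_on_const linear_continuous_on)
  then have closed: "closed (E n)" for n
    by (auto simp: E_def)
  have cover: "\<Union> (range E) = UNIV"
  proof -
    have "\<exists>n. x \<in> E n" for x
    proof -
      obtain M where M: "\<forall>f\<in>F. norm (f x) \<le> M"
        using ptw by blast
      obtain n where "M \<le> real n"
        using real_arch_simple by blast
      with M have "x \<in> E n"
        unfolding E_def using order_trans by blast
      then show ?thesis ..
    qed
    then show ?thesis
      by blast
  qed
  have "\<exists>n. interior (E n) \<noteq> {}"
  proof (rule ccontr)
    assume "\<not> ?thesis"
    then have "euclidean interior_of \<Union> (range E) = {}"
      using closed
      by (intro Baire_category_alt disjI1 completely_metrizable_space_euclidean) auto
    then show False
      by (simp add: cover)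
  qed
  then obtain n a where "a \<in> interior (E n)"
    by blast
  then obtain r where r: "0 < r" "cball a r \<subseteq> E n"
    using mem_interior_cball by blast
  have "norm (f x) \<le> 2 * real n / r * norm x" if f: "f \<in> F" for f x
  proof (cases "x = 0")
    case True
    then show ?thesis
      using linear_0[OF bounded_linear.linear[OF lin[OF f]]] by simp
  next
    case False
    interpret f: bounded_linear f
      by (rule lin[OF f])
    \<comment> \<open>\<open>y\<close> has norm \<open>r\<close>, so \<open>a\<close> and
      \<open>a + y\<close> both lie in the ball; writing \<open>f y\<close> as a difference moves
      the bound to the origin at the cost of a factor 2.\<close>
    define y where "y = (r / norm x) *\<^sub>R x"
    have "a \<in> cball a r" "a + y \<in> cball a r"
      using r(1) False by (auto simp: y_def dist_norm)
    then have "a \<in> E n" "a + y \<in> E n"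
      using r(2) by blast+
    then have "norm (f a) \<le> real n" "norm (f a + f y) \<le> real n"
      using f by (auto simp: E_def f.add)
    then have "norm (f y) \<le> 2 * real n"
      using norm_triangle_ineq4[of "f a + f y" "f a"] by simp
    then show ?thesis
      using r False by (simp add: y_def f.scaleR field_simps)
  qed
  then show ?thesis
    by blast
qed

section \<open>Existence and uniqueness of adjoints\<close>

lemma bounded_linear_cinner_right: "bounded_linear (\<lambda>x::'a::complex_inner_space. cinner y x)"
  using bounded_linear_compose[OF bounded_linear_cnj bounded_linear_cinner_left[of y]]
  by (simp flip: cinner_commute)

lemma bounded_linear_scaleC: "bounded_linear (scaleC c :: 'a::complex_inner_space \<Rightarrow> 'a)"
  by (rule bounded_linear_intro[where K = "cmod c"])
    (simp_all add: scaleC_add_right scaleR_scaleC scaleC_scaleC norm_scaleC mult.commute)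

text \<open>Riesz gives each value \<open>S y\<close>; linearity follows from nondegeneracy, and
  boundedness from \<open>\<parallel>S y\<parallel>^2 = Re \<langle>T (S y), y\<rangle>\<close> with
  a bound for \<open>T\<close>.\<close>

lemma bounded_clinear_adjoint_exists:
  fixes T :: "'a::complex_hilbert_space \<Rightarrow> 'a"
  assumes "bounded_clinear T"
  shows "\<exists>S. bounded_clinear S \<and> (\<forall>x y. cinner (T x) y = cinner x (S y))"
proof -
  have T: "bounded_linear T" and TC: "\<And>c x. T (scaleC c x) = scaleC c (T x)"
    using assms by (auto simp: bounded_clinear_def)
  have "\<exists>v. \<forall>x. cinner (T x) y = cinner x v" for y
  proof -
    have "bounded_linear (\<lambda>x. Re (cinner (T x) y))"
      using bounded_linear_compose[OF bounded_linear_Re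
          bounded_linear_compose[OF bounded_linear_cinner_left T]] .
    from Riesz_on_subspace[OF this, of UNIV] obtain v
      where v: "\<And>x. Re (cinner (T x) y) = Re (cinner x v)"
      by auto
    \<comment> \<open>The Riesz vector matches real parts only; evaluating at \<open>i x\<close>
      recovers the imaginary part.\<close>
    have "Im (cinner (T x) y) = Im (cinner x v)" for x
      using v[of "scaleC \<i> x"] by (simp add: TC cinner.scaleC_left)
    with v show ?thesis
      by (auto simp: complex_eq_iff)
  qed
  then obtain S where S: "\<And>x y. cinner (T x) y = cinner x (S y)"
    by metis
  obtain K where K: "\<And>x. norm (T x) \<le> norm x * K" "0 \<le> K"
    using bounded_linear.nonneg_bounded[OF T] by auto
  have SC: "S (scaleC c y) = scaleC c (S y)" for c y
    by (rule cinner_eqI) (simp add: cinner.scaleC_right flip: S)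
  have "bounded_linear S"
  proof (rule bounded_linear_intro)
    show "S (x + y) = S x + S y" for x y
      by (rule cinner_eqI) (simp add: cinner.add_right flip: S)
    show "S (r *\<^sub>R x) = r *\<^sub>R S x" for r x
      by (simp add: scaleR_scaleC SC)
    show "norm (S y) \<le> norm y * K" for y
    proof -
      have "(norm (S y))\<^sup>2 = Re (cinner (T (S y)) y)"
        by (simp add: S cinner.seminorm_power2)
      also have "\<dots> \<le> norm (T (S y)) * norm y"
        using cinner.Cauchy_Schwarz complex_Re_le_cmod order_trans by blast
      also have "\<dots> \<le> norm (S y) * K * norm y"
        by (rule mult_right_mono[OF K(1)]) simp
      finally have "norm (S y) * norm (S y) \<le> norm (S y) * (norm y * K)"
        by (simp add: power2_eq_square mult_ac)
      then show ?thesis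
        using K(2) by (cases "S y = 0") auto
    qed
  qed
  with S SC show ?thesis
    unfolding bounded_clinear_def by blast
qed

lemma adjoint_op:
  fixes T :: "'a::complex_hilbert_space \<Rightarrow> 'a"
  assumes "bounded_clinear T"
  shows bounded_clinear_adjoint_op: "bounded_clinear (adjoint_op T)"
    and cinner_adjoint_op: "cinner (T x) y = cinner x (adjoint_op T y)"
proof -
  let ?P = "\<lambda>S. bounded_clinear S \<and> (\<forall>x y. cinner (T x) y = cinner x (S y))"
  have "\<exists>!S. ?P S"
    using bounded_clinear_adjoint_exists[OF assms]
    by (rule ex_ex1I) (metis cinner_eqI ext)
  then have "?P (adjoint_op T)"
    unfolding adjoint_op_def by (rule theI')
  then show "bounded_clinear (adjoint_op T)" "cinner (T x) y = cinner x (adjoint_op T y)"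
    by auto
qed

section \<open>Positive operators and the \<open>A\<close>-seminorm\<close>

lemma subspace_closure:
  fixes S :: "'a::real_normed_vector set"
  assumes S: "subspace S"
  shows "subspace (closure S)"
proof (rule subspaceI)
  show "0 \<in> closure S"
    using subspace_0[OF S] closure_subset by blast
  show "x + y \<in> closure S" if x: "x \<in> closure S" and y: "y \<in> closure S" for x y
  proof -
    obtain a where "\<And>n. a n \<in> S" "a \<longlonglongrightarrow> x"
      using x unfolding closure_sequential by blast
    moreover obtain b where "\<And>n. b n \<in> S" "b \<longlonglongrightarrow> y"
      using y unfolding closure_sequential by blast
    ultimately show ?thesis
      unfolding closure_sequential
      by (intro exI[of _ "\<lambda>n. a n + b n"]) (simp add: tendsto_add subspace_add[OF S])
  qed
  show "c *\<^sub>R x \<in> closure S" if x: "x \<in> closure S" for c x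
  proof -
    obtain a where "\<And>n. a n \<in> S" "a \<longlonglongrightarrow> x"
      using x unfolding closure_sequential by blast
    then show ?thesis
      unfolding closure_sequential
      by (intro exI[of _ "\<lambda>n. c *\<^sub>R a n"]) (simp add: tendsto_scaleR subspace_scale[OF S])
  qed
qed

locale positive_operator =
  fixes A :: "'a::complex_hilbert_space \<Rightarrow> 'a"
  assumes positive: "positive_op A"
begin

lemma bounded_linear: "bounded_linear A"
  and scaleC: "A (scaleC c x) = scaleC c (A x)"
  and cinner_self_real: "Im (cinner (A x) x) = 0"
  and cinner_self_nonneg: "0 \<le> Re (cinner (A x) x)"
  using positive by (auto simp: positive_op_def bounded_clinear_def complex_nonneg_Reals_iff)

lemma add: "A (x + y) = A x + A y"
  by (rule linear_add[OF bounded_linear.linear[OF bounded_linear]])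

lemma diff: "A (x - y) = A x - A y"
  by (rule linear_diff[OF bounded_linear.linear[OF bounded_linear]])

text \<open>Polarization: the quadratic form is real at \<open>x + y\<close>, which relates the
  imaginary parts, and at \<open>x + i y\<close>, which relates the real parts.\<close>

lemma self_adjoint: "cinner (A x) y = cinner x (A y)"
proof -
  have "Im (cinner (A x) y) + Im (cinner (A y) x) = 0"
    using cinner_self_real[of "x + y"] cinner_self_real[of x] cinner_self_real[of y]
    by (simp add: add cinner.add_left cinner.add_right)
  moreover have "Re (cinner (A y) x) = Re (cinner (A x) y)"
    using cinner_self_real[of "x + scaleC \<i> y"] cinner_self_real[of x] cinner_self_real[of y]
    by (simp add: add scaleC cinner.add_left cinner.add_right cinner.scaleC_left cinner.scaleC_right)
  ultimately have "cinner (A x) y = cnj (cinner (A y) x)"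
    by (simp add: complex_eq_iff)
  then show ?thesis
    using cinner_commute by metis
qed

sublocale semi_inner "A_inner A"
  rewrites "semi_inner.seminorm (A_inner A) = A_norm A"
proof -
  show *: "semi_inner (A_inner A)"
  proof
    show "A_inner A x y = cnj (A_inner A y x)" for x y
      unfolding A_inner_def by (metis cinner_commute self_adjoint)
  qed (simp_all add: A_inner_def add scaleC cinner.add_left cinner.scaleC_left cinner_self_nonneg)
  show "semi_inner.seminorm (A_inner A) = A_norm A"
    by (rule ext) (simp add: semi_inner.seminorm_def[OF *] A_norm_def)
qed

lemma A_norm_le: "\<exists>K\<ge>0. \<forall>x. A_norm A x \<le> K * norm x"
proof -
  obtain K where K: "\<And>x. norm (A x) \<le> norm x * K" "0 \<le> K"
    using bounded_linear.nonneg_bounded[OF bounded_linear] by auto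
  have "A_norm A x \<le> sqrt K * norm x" for x
  proof (rule power2_le_imp_le)
    have "(A_norm A x)\<^sup>2 \<le> norm (A x) * norm x"
      unfolding seminorm_power2 A_inner_def
      using cinner.Cauchy_Schwarz complex_Re_le_cmod order_trans by blast
    also have "\<dots> \<le> norm x * K * norm x"
      by (rule mult_right_mono[OF K(1)]) simp
    finally show "(A_norm A x)\<^sup>2 \<le> (sqrt K * norm x)\<^sup>2"
      using K(2) by (simp add: power_mult_distrib) (simp add: power2_eq_square mult_ac)
  qed (simp add: K(2))
  then show ?thesis
    using K(2) by (intro exI[of _ "sqrt K"]) simp
qed

text \<open>Makes the index set of the suprema nonempty. By Cauchy-Schwarz against
  \<open>A x\<close>, a vector of \<open>A\<close>-seminorm zero satisfies
  \<open>\<langle>A x, A x\<rangle> = 0\<close>, so any \<open>x\<close> outside the kernel can be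
  normalised.\<close>

lemma ex_A_norm_1:
  assumes "A \<noteq> (\<lambda>x. 0)"
  shows "\<exists>x. A_norm A x = 1"
proof -
  obtain x where x: "A x \<noteq> 0"
    using assms by auto
  have "A_norm A x \<noteq> 0"
  proof
    assume "A_norm A x = 0"
    then have "A_inner A x (A x) = 0"
      using Cauchy_Schwarz[of x "A x"] by simp
    with x show False
      by (simp add: A_inner_def cinner_self_eq_zero_iff)
  qed
  then have pos: "0 < A_norm A x"
    using seminorm_nonneg[of x] by linarith
  define r where "r = 1 / A_norm A x"
  have "(A_norm A (scaleC (complex_of_real r) x))\<^sup>2 = r\<^sup>2 * (A_norm A x)\<^sup>2"
    unfolding seminorm_power2 by (simp add: scaleC_left scaleC_right power2_eq_square)
  also have "\<dots> = 1"
    using pos by (simp add: r_def power_divide)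
  finally have "A_norm A (scaleC (complex_of_real r) x) = 1"
    using seminorm_nonneg by (simp add: power2_eq_1_iff) (smt (verit) seminorm_nonneg)
  then show ?thesis ..
qed

section \<open>The closure of the range of \<open>A\<close> and the distinguished
  \<open>A\<close>-adjoint\<close>

lemma closure_range_scaleC: "v \<in> closure (range A) \<Longrightarrow> scaleC c v \<in> closure (range A)"
proof -
  have "scaleC c ` range A \<subseteq> range A"
    by (auto simp flip: scaleC)
  then show "v \<in> closure (range A) \<Longrightarrow> scaleC c v \<in> closure (range A)"
    using closure_bounded_linear_image_subset[OF bounded_linear_scaleC, of c "range A"]
      closure_mono by blast
qed

lemma subspace_closure_range: "subspace (closure (range A))"
  by (intro subspace_closure linear_subspace_image bounded_linear.linear bounded_linear subspace_UNIV)

text \<open>The kernel of a self-adjoint operator is orthogonal to the closure of its range, so the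
  difference \<open>d\<close>, lying in both, is orthogonal to itself.\<close>

lemma inj_on_closure_range:
  assumes "u \<in> closure (range A)" "v \<in> closure (range A)" "A u = A v"
  shows "u = v"
proof -
  define d where "d = u - v"
  have "A d = 0"
    using assms by (simp add: d_def diff)
  then have "range A \<subseteq> {w. cinner w d = 0}"
    by (auto simp: self_adjoint)
  moreover have "closed {w. cinner w d = 0}"
    by (intro closed_Collect_eq continuous_on_const linear_continuous_on bounded_linear_cinner_left)
  moreover have "d \<in> closure (range A)"
    unfolding d_def using assms subspace_closure_range by (intro subspace_diff)
  ultimately have "cinner d d = 0"
    using closure_minimal by blast
  then show ?thesis
    by (simp add: d_def cinner_self_eq_zero_iff)
qed

text \<open>\<open>v\<close> is the orthogonal projection of \<open>y\<close> onto the closure of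
  the range; \<open>y - v\<close> is orthogonal to the range, hence in the kernel of
  \<open>A\<close>.\<close>

lemma closure_range_preimage:
  "\<exists>v\<in>closure (range A). A v = A y"
proof -
  have "bounded_linear (\<lambda>x. Re (cinner x y))"
    using bounded_linear_compose[OF bounded_linear_Re bounded_linear_cinner_left] .
  from Riesz_on_subspace[OF this subspace_closure_range closed_closure] obtain v
    where v: "v \<in> closure (range A)"
      and eq: "\<And>x. x \<in> closure (range A) \<Longrightarrow> Re (cinner x y) = Re (cinner x v)"
    by blast
  have "A v = A y"
  proof (rule cinner_eqI)
    fix z
    have "Re (cinner (A z) y) = Re (cinner (A z) v)" for z
      by (intro eq subsetD[OF closure_subset] rangeI)
    from this[of z] this[of "scaleC \<i> z"] show "cinner z (A v) = cinner z (A y)"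
      by (simp add: scaleC cinner.scaleC_left complex_eq_iff flip: self_adjoint)
  qed
  with v show ?thesis
    by blast
qed

text \<open>\<open>X\<close> is automatically bounded, by uniform boundedness of the functionals
  \<open>\<langle>X x, A z\<rangle> = \<langle>R x, z\<rangle>\<close> of \<open>x\<close> with \<open>\<parallel>A z\<parallel> \<le> 1\<close>.\<close>

lemma bounded_clinear_lift:
  fixes R X :: "'b::complex_hilbert_space \<Rightarrow> 'a"
  assumes R: "bounded_clinear R"
    and X: "\<And>x. X x \<in> closure (range A)" "\<And>x. A (X x) = R x"
  shows "bounded_clinear X"
proof -
  have Rb: "bounded_linear R" and RC: "\<And>c x. R (scaleC c x) = scaleC c (R x)"
    using R by (auto simp: bounded_clinear_def)
  have Xadd: "X (x + y) = X x + X y" for x y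
  proof (rule inj_on_closure_range)
    show "X x + X y \<in> closure (range A)"
      by (intro subspace_add subspace_closure_range X)
    show "A (X (x + y)) = A (X x + X y)"
      using linear_add[OF bounded_linear.linear[OF Rb]] by (simp add: add X)
  qed (rule X)
  have XC: "X (scaleC c x) = scaleC c (X x)" for c x
    by (rule inj_on_closure_range) (simp_all add: X closure_range_scaleC scaleC RC)
  \<comment> \<open>Division by zero yields 0, so \<open>\<phi> z\<close> vanishes when
    \<open>A z = 0\<close>. This form bounds \<open>\<phi> z x\<close> by \<open>norm (X x)\<close>;
    the rewritten form below, via \<open>R\<close>, shows that each \<open>\<phi> z\<close> is
    bounded linear.\<close>
  define \<phi> where "\<phi> z x = cinner (X x) ((1 / norm (A z)) *\<^sub>R A z)" for z x
  have \<phi>: "\<phi> z = (\<lambda>x. cinner (R x) ((1 / norm (A z)) *\<^sub>R z))" for z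
    by (rule ext)
      (simp add: \<phi>_def X(2)[symmetric] self_adjoint
        linear_scale[OF bounded_linear.linear[OF bounded_linear]])
  have "\<exists>C. \<forall>f\<in>range \<phi>. \<forall>x. norm (f x) \<le> C * norm x"
  proof (rule uniform_boundedness)
    show "bounded_linear f" if "f \<in> range \<phi>" for f
      using that bounded_linear_compose[OF bounded_linear_cinner_left Rb] by (auto simp: \<phi>)
    have "norm (\<phi> z x) \<le> norm (X x)" for x z
    proof -
      have "norm ((1 / norm (A z)) *\<^sub>R A z) \<le> 1"
        by simp
      then show ?thesis
        unfolding \<phi>_def
        by (meson cinner.Cauchy_Schwarz mult_left_le norm_ge_zero order_trans)
    qed
    then show "\<exists>M. \<forall>f\<in>range \<phi>. norm (f x) \<le> M" for x
      by blast
  qed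
  then obtain C where C: "\<And>z x. cmod (\<phi> z x) \<le> C * norm x"
    by auto
  have le: "norm (X x) \<le> norm x * \<bar>C\<bar>" for x
  proof -
    \<comment> \<open>\<open>?U\<close> is closed and contains the range, hence contains
      \<open>X x\<close> itself; testing there bounds
      \<open>\<parallel>X x\<parallel>^2\<close>.\<close>
    let ?U = "{w. cmod (cinner (X x) w) \<le> C * norm x * norm w}"
    have "cmod (cinner (X x) (A z)) \<le> C * norm x * norm (A z)" for z
    proof (cases "A z = 0")
      case False
      have "cmod (\<phi> z x) = cmod (cinner (X x) (A z)) / norm (A z)"
        unfolding \<phi>_def scaleR_scaleC cinner.scaleC_right by (simp add: norm_mult norm_divide)
      then show ?thesis
        using mult_right_mono[OF C[of z x], of "norm (A z)"] False by simp
    qed simp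
    then have "range A \<subseteq> ?U"
      by blast
    moreover have "closed ?U"
      by (intro closed_Collect_le continuous_on_norm continuous_on_mult_left continuous_on_id
          linear_continuous_on bounded_linear_cinner_right)
    ultimately have "X x \<in> ?U"
      using closure_minimal X(1) by blast
    moreover have "cmod (cinner (X x) (X x)) = (norm (X x))\<^sup>2"
      using cinner.self_complex[of "X x"]
      by (metis abs_of_nonneg cinner.nonneg cinner.seminorm_power2 norm_of_real)
    ultimately have "norm (X x) * norm (X x) \<le> C * norm x * norm (X x)"
      by (simp add: power2_eq_square)
    then have "norm (X x) \<le> C * norm x \<or> X x = 0"
      by auto
    moreover have "C * norm x \<le> norm x * \<bar>C\<bar>"
      using mult_right_mono[OF abs_ge_self norm_ge_zero] by (simp add: mult.commute)
    ultimately show ?thesis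
      by auto
  qed
  have "bounded_linear X"
    by (rule bounded_linear_intro[OF Xadd _ le]) (simp add: scaleR_scaleC XC)
  with XC show ?thesis
    by (simp add: bounded_clinear_def)
qed

text \<open>The range condition puts \<open>adjoint_op T (A x)\<close> in the range of
  \<open>A\<close>; replacing a preimage by its projection gives the values of \<open>X\<close>.
  Injectivity on the closure makes \<open>X\<close> unique, so the description in
  \<open>A_sharp\<close> denotes.\<close>

lemma A_sharp:
  assumes "T \<in> A_adjointable A"
  shows bounded_clinear_A_sharp: "bounded_clinear (A_sharp A T)"
    and A_inner_A_sharp: "A_inner A (A_sharp A T x) y = A_inner A x (T y)"
proof -
  have T: "bounded_clinear T" and ran: "\<And>x. adjoint_op T (A x) \<in> range A"
    using assms by (auto simp: A_adjointable_def)
  let ?R = "adjoint_op T \<circ> A"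
  let ?P = "\<lambda>X. bounded_clinear X \<and> A \<circ> X = ?R \<and> range X \<subseteq> closure (range A)"
  have R: "bounded_clinear ?R"
    using bounded_clinear_adjoint_op[OF T] bounded_linear
    by (auto simp: bounded_clinear_def scaleC bounded_linear_compose comp_def)
  have "\<exists>v\<in>closure (range A). A v = ?R x" for x
    using ran[of x] closure_range_preimage by force
  then obtain X where X: "\<And>x. X x \<in> closure (range A)" "\<And>x. A (X x) = ?R x"
    by metis
  have "\<exists>!X. ?P X"
  proof (rule ex1I)
    show "?P X"
      using X bounded_clinear_lift[OF R X] by auto
    show "Y = X" if "?P Y" for Y
    proof
      fix x
      have "A (Y x) = A (X x)"
        using that X(2)[of x] by (metis comp_apply)
      with that X(1) show "Y x = X x"
        by (intro inj_on_closure_range[of "Y x" "X x"]) auto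
    qed
  qed
  then have P: "?P (A_sharp A T)"
    unfolding A_sharp_def by (rule theI')
  then show "bounded_clinear (A_sharp A T)"
    by simp
  have "A (A_sharp A T x) = adjoint_op T (A x)"
    using P by (metis comp_apply)
  then have "A_inner A (A_sharp A T x) y = cnj (cinner y (adjoint_op T (A x)))"
    unfolding A_inner_def by (metis cinner_commute)
  also have "\<dots> = A_inner A x (T y)"
    unfolding A_inner_def cinner_adjoint_op[OF T, symmetric] by (metis cinner_commute)
  finally show "A_inner A (A_sharp A T x) y = A_inner A x (T y)" .
qed

section \<open>Finiteness of the suprema\<close>

lemma A_numerical_radius_upper:
  assumes "\<And>x. A_norm A x = 1 \<Longrightarrow> cmod (A_inner A (B x) x) \<le> M" and "A_norm A x = 1"
  shows "cmod (A_inner A (B x) x) \<le> A_numerical_radius A B"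
  unfolding A_numerical_radius_def
  \<comment> \<open>\<open>M\<close> witnesses that the real \<open>SUP\<close> is over a set
    bounded above.\<close>
  using assms by (intro cSUP_upper bdd_aboveI2[where M = M]) auto

text \<open>A norm bound \<open>c\<close> for \<open>S = A_sharp A T \<circ> T\<close> controls the
  growth of \<open>S^n x\<close> in the \<open>A\<close>-seminorm. The prefactor
  \<open>K * norm x\<close> depends on \<open>x\<close>, but Krein's argument keeps only the rate
  \<open>c\<close>.\<close>

lemma A_norm_sharp_comp_le:
  assumes T: "T \<in> A_adjointable A"
  shows "\<exists>c>0. \<forall>x. A_norm A (A_sharp A T (T x)) \<le> c * A_norm A x"
proof -
  let ?S = "A_sharp A T \<circ> T"
  have "bounded_linear ?S"
    using bounded_clinear_A_sharp[OF T] T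
    by (auto simp: A_adjointable_def bounded_clinear_def comp_def intro: bounded_linear_compose)
  then obtain c where c: "0 < c" "\<And>x. norm (?S x) \<le> norm x * c"
    using bounded_linear.pos_bounded by blast
  obtain K where K: "0 \<le> K" "\<And>x. A_norm A x \<le> K * norm x"
    using A_norm_le by blast
  have sym: "A_inner A (?S x) y = A_inner A x (?S y)" for x y
    using A_inner_A_sharp[OF T] hermitian by (metis comp_apply)
  have pow: "norm ((?S ^^ n) x) \<le> norm x * c ^ n" for n x
  proof (induction n)
    case (Suc n)
    have "norm ((?S ^^ Suc n) x) \<le> norm ((?S ^^ n) x) * c"
      using c(2)[of "(?S ^^ n) x"] by simp
    also have "\<dots> \<le> norm x * c ^ n * c"
      by (rule mult_right_mono[OF Suc less_imp_le[OF c(1)]])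
    finally show ?case
      by (simp only: power_Suc mult_ac)
  qed simp
  have "A_norm A ((?S ^^ n) x) \<le> K * norm x * c ^ n" for n x
    using order_trans[OF K(2) mult_left_mono[OF pow K(1)]] by (simp add: mult.assoc)
  from symmetric_seminorm_le[OF sym c(1) this] have "A_norm A (?S x) \<le> c * A_norm A x" for x .
  with c(1) show ?thesis
    by auto
qed

end

section \<open>The bound for the \<open>A\<close>-Davis-Wielandt radius\<close>

theorem corollary2p2:
  fixes A T :: "'a::complex_hilbert_space \<Rightarrow> 'a"
  assumes "positive_op A"
    and "A \<noteq> (\<lambda>x. 0)"
    and "T \<in> A_adjointable A"
  shows "A_Davis_Wielandt_radius A T \<le>
    sqrt (1 / 2 *
        (A_numerical_radius A (\<lambda>x. ((A_sharp A T \<circ> T) ^^ 2) x + (A_sharp A T \<circ> T) x)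
         + A_numerical_radius A (\<lambda>x. ((A_sharp A T \<circ> T) ^^ 2) x - (A_sharp A T \<circ> T) x))
      + A_numerical_radius A (A_sharp A T \<circ> T \<circ> T))"
proof -
  interpret positive_operator A
    using assms(1) by unfold_locales
  define S where "S = A_sharp A T \<circ> T"
  note sharp = A_inner_A_sharp[OF assms(3)]
  have sharp': "A_inner A x (A_sharp A T y) = A_inner A (T x) y" for x y
    by (metis hermitian sharp)
  obtain c where c: "0 < c" "\<And>x. A_norm A (S x) \<le> c * A_norm A x"
    using A_norm_sharp_comp_le[OF assms(3)] by (auto simp: S_def)
  have S1: "A_inner A (S x) x = complex_of_real ((A_norm A (T x))\<^sup>2)" for x
    using self_complex[of "T x"] by (simp add: S_def sharp seminorm_power2)
  have S2: "A_inner A ((S ^^ 2) x) x = complex_of_real ((A_norm A (S x))\<^sup>2)" for x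
  proof -
    have "A_inner A ((S ^^ 2) x) x = A_inner A (S x) (S x)"
      by (simp add: S_def sharp sharp' numeral_2_eq_2)
    then show ?thesis
      using self_complex[of "S x"] by (simp add: seminorm_power2)
  qed
  define B1 where "B1 = (\<lambda>x. (S ^^ 2) x + S x)"
  define B2 where "B2 = (\<lambda>x. (S ^^ 2) x - S x)"
  define B3 where "B3 = S \<circ> T"
  \<comment> \<open>The form of \<open>S^2 + S\<close> is real and nonnegative, so its modulus is
    the sum itself; for \<open>S^2 - S\<close> the modulus is the absolute difference.\<close>
  have B1: "cmod (A_inner A (B1 x) x) = (A_norm A (S x))\<^sup>2 + (A_norm A (T x))\<^sup>2" for x
  proof -
    have "A_inner A (B1 x) x = complex_of_real ((A_norm A (S x))\<^sup>2 + (A_norm A (T x))\<^sup>2)"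
      unfolding B1_def add_left S1 S2 by simp
    then show ?thesis
      by (metis abs_of_nonneg add_nonneg_nonneg norm_of_real zero_le_power2)
  qed
  have B2: "cmod (A_inner A (B2 x) x) = \<bar>(A_norm A (S x))\<^sup>2 - (A_norm A (T x))\<^sup>2\<bar>" for x
    unfolding B2_def diff_left S1 S2 by (metis norm_of_real of_real_diff)
  \<comment> \<open>Both sides have the modulus of \<open>\<langle>T (T x), T x\<rangle>\<close> in
    the \<open>A\<close>-form.\<close>
  have B3: "cmod (A_inner A (B3 x) x) = cmod (A_inner A (T x) (S x))" for x
    by (metis B3_def S_def cmod_commute comp_apply sharp)
  \<comment> \<open>On unit vectors \<open>\<parallel>T x\<parallel>^2 = \<langle>S x, x\<rangle>
    \<le> \<parallel>S x\<parallel> \<le> c\<close> in the \<open>A\<close>-seminorm, so the one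
    constant \<open>c\<close> bounds all three suprema.\<close>
  have T_le: "(A_norm A (T x))\<^sup>2 \<le> c" and S_le: "A_norm A (S x) \<le> c" if "A_norm A x = 1" for x
  proof -
    show "A_norm A (S x) \<le> c"
      using c(2)[of x] that by simp
    moreover have "(A_norm A (T x))\<^sup>2 \<le> A_norm A (S x)"
      using Cauchy_Schwarz[of "S x" x] that unfolding S1 norm_of_real by simp
    ultimately show "(A_norm A (T x))\<^sup>2 \<le> c"
      by simp
  qed
  have T_le': "A_norm A (T x) \<le> sqrt c" if "A_norm A x = 1" for x
    using T_le[OF that] by (rule real_le_rsqrt)
  have S_sq: "(A_norm A (S x))\<^sup>2 \<le> c\<^sup>2" if "A_norm A x = 1" for x
    using S_le[OF that] by (simp add: power_mono)
  have r1: "cmod (A_inner A (B1 x) x) \<le> A_numerical_radius A B1" if "A_norm A x = 1" for x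
  proof (rule A_numerical_radius_upper[OF _ that])
    show "cmod (A_inner A (B1 x) x) \<le> c\<^sup>2 + c" if "A_norm A x = 1" for x
      unfolding B1 using S_sq[OF that] T_le[OF that] by simp
  qed
  have r2: "cmod (A_inner A (B2 x) x) \<le> A_numerical_radius A B2" if "A_norm A x = 1" for x
  proof (rule A_numerical_radius_upper[OF _ that])
    show "cmod (A_inner A (B2 x) x) \<le> c\<^sup>2 + c" if "A_norm A x = 1" for x
      unfolding B2 using S_sq[OF that] T_le[OF that]
        zero_le_power2[of "A_norm A (S x)"] zero_le_power2[of "A_norm A (T x)"]
        zero_le_power2[of c] c(1) by linarith
  qed
  have r3: "cmod (A_inner A (B3 x) x) \<le> A_numerical_radius A B3" if "A_norm A x = 1" for x
  proof (rule A_numerical_radius_upper[OF _ that])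
    show "cmod (A_inner A (B3 x) x) \<le> sqrt c * c" if "A_norm A x = 1" for x
      unfolding B3 using Cauchy_Schwarz[of "T x" "S x"]
        mult_mono[OF T_le'[OF that] S_le[OF that]] c(1) by simp
  qed
  have "A_Davis_Wielandt_radius A T \<le>
    sqrt (1 / 2 * (A_numerical_radius A B1 + A_numerical_radius A B2) + A_numerical_radius A B3)"
    unfolding A_Davis_Wielandt_radius_def
  proof (rule cSUP_least)
    show "{x. A_norm A x = 1} \<noteq> {}"
      using ex_A_norm_1[OF assms(2)] by blast
    fix x
    assume "x \<in> {x. A_norm A x = 1}"
    then have x: "A_norm A x = 1"
      by simp
    \<comment> \<open>Rewriting the maximum this way produces exactly the moduli in
      \<open>B1\<close> and \<open>B2\<close>.\<close>
    have max_eq: "max p q = 1 / 2 * (q + p + \<bar>q - p\<bar>)" for p q :: real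
      by (simp add: max_def abs_if)
    have "(cmod (A_inner A (T x) x))\<^sup>2 + A_norm A (T x) ^ 4
        = (cmod (A_inner A x (T x)))\<^sup>2 + (cmod (A_inner A x (S x)))\<^sup>2"
      unfolding cmod_commute[of x] S1 by (simp add: norm_power flip: power_mult)
    also have "\<dots> \<le> max ((A_norm A (T x))\<^sup>2) ((A_norm A (S x))\<^sup>2) + cmod (A_inner A (T x) (S x))"
      using sum_square_inner_le[of x "T x" "S x"] x by simp
    also have "\<dots> = 1 / 2 * (cmod (A_inner A (B1 x) x) + cmod (A_inner A (B2 x) x))
        + cmod (A_inner A (B3 x) x)"
      unfolding B1 B2 B3 max_eq by simp
    also have "\<dots> \<le> 1 / 2 * (A_numerical_radius A B1 + A_numerical_radius A B2)
        + A_numerical_radius A B3"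
      by (intro add_mono mult_left_mono r1 r2 r3 x) simp
    finally show "sqrt ((cmod (A_inner A (T x) x))\<^sup>2 + A_norm A (T x) ^ 4)
      \<le> sqrt (1 / 2 * (A_numerical_radius A B1 + A_numerical_radius A B2) + A_numerical_radius A B3)"
      by (rule real_sqrt_le_mono)
  qed
  then show ?thesis
    by (simp only: B1_def B2_def B3_def S_def)
qed

end
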